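(* Let $\mu$ be a Borel probability measure on $\mathbb{R}$ such that all polynomials belong to $L^2(\mu)$ and the polynomials are dense in $L^2(\mu)$. Suppose that $\operatorname{supp}(\mu)\subseteq[0,\infty)$, that $0\in\operatorname{supp}(\mu)$ and $0$ is not an isolated point of $\operatorname{supp}(\mu)$, and that $\mu(\{0\})=0$. Then for any $n\in\mathbb{N}_0=\{0,1,2,\ldots\}$, the finite linear combinations of the polynomials $\{x^j\}_{j=n+1}^{\infty}$ are dense in $L^2(\mu)$.
   Context: $L^2(\mu)$ is the Hilbert space of complex-valued square-integrable functions, with complex linear combinations. $\operatorname{supp}(\mu)$ denotes the (closed) topological support of $\mu$. *)

theory Defs
  imports "HOL-Probability.Probability" "HOL-Computational_Algebra.Polynomial"
begin

(* Elements of the space are represented by functions, not by classes modulo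
   equality almost everywhere; L2_norm below is the norm of the class, and
   L2_norm M f = 0 iff f vanishes almost everywhere, for f in L2_space M. *)
definition L2_space :: "'a measure \<Rightarrow> ('a \<Rightarrow> complex) set" where
  "L2_space M = {f \<in> borel_measurable M. integrable M (\<lambda>x. (norm (f x))\<^sup>2)}"

definition L2_norm :: "'a measure \<Rightarrow> ('a \<Rightarrow> complex) \<Rightarrow> real" where
  "L2_norm M f = sqrt (\<integral>x. (norm (f x))\<^sup>2 \<partial>M)"

definition L2_dense :: "'a measure \<Rightarrow> ('a \<Rightarrow> complex) set \<Rightarrow> bool" where
  "L2_dense M S \<longleftrightarrow> S \<subseteq> L2_space M \<and>
     (\<forall>f\<in>L2_space M. \<forall>\<epsilon>>0. \<exists>g\<in>S. L2_norm M (\<lambda>x. f x - g x) < \<epsilon>)"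

definition msupport :: "'a::topological_space measure \<Rightarrow> 'a set" where
  "msupport M = {x. \<forall>U. open U \<and> x \<in> U \<longrightarrow> emeasure M U > 0}"

definition poly_fun :: "complex poly \<Rightarrow> real \<Rightarrow> complex" where
  "poly_fun p x = poly p (complex_of_real x)"

definition fin_lin_combs :: "('i \<Rightarrow> 'a \<Rightarrow> complex) \<Rightarrow> 'i set \<Rightarrow> ('a \<Rightarrow> complex) set" where
  "fin_lin_combs e I = {(\<lambda>x. \<Sum>j\<in>J. c j * e j x) | J c. finite J \<and> J \<subseteq> I}"

end

(* It suffices to see that x^k lies in the closure of x^(k+1) C[x] for every k, that is, that for
   nu = x^(2k) mu there are polynomials r with r(0) = 1 and arbitrarily small norm in L^2(nu).
   Otherwise evaluation at 0 is bounded on polynomials in L^2(nu), and then so is evaluation at -t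
   for some t > 0.  Boundedness at -t makes the trace of multiplication by 1/(x+t), computed in the
   orthonormal polynomials, finite; positivity of this operator rests on nu living on the
   half-line.  Finite trace forces the integral of p^2 over (0,delta) to be at most 1/8 of its
   total integral, for some delta > 0 and every p, so the indicator function of (0,delta), which
   is not null because 0 is in the support and is not an atom, cannot be approximated. *)
theory Submission
  imports Defs
begin

section \<open>Elementary inequalities and division by linear factors\<close>

lemma power2_diff_le: "(a - b)\<^sup>2 \<le> 2 * a\<^sup>2 + 2 * b\<^sup>2" for a b :: real
  using zero_le_power2[of "a + b"] by (simp add: power2_eq_square algebra_simps)

lemma integrable_mult_of_squares:
  fixes f g :: "'a \<Rightarrow> real"
  assumes [measurable]: "f \<in> borel_measurable M" "g \<in> borel_measurable M"
    and "integrable M (\<lambda>x. (f x)\<^sup>2)" "integrable M (\<lambda>x. (g x)\<^sup>2)"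
  shows "integrable M (\<lambda>x. f x * g x)"
proof (rule Bochner_Integration.integrable_bound)
  show "integrable M (\<lambda>x. (f x)\<^sup>2 + (g x)\<^sup>2)" using assms by simp
  show "AE x in M. norm (f x * g x) \<le> norm ((f x)\<^sup>2 + (g x)\<^sup>2)"
  proof (rule AE_I2)
    fix x
    have "2 * (\<bar>f x\<bar> * \<bar>g x\<bar>) \<le> (f x)\<^sup>2 + (g x)\<^sup>2"
      using sum_squares_bound[of "\<bar>f x\<bar>" "\<bar>g x\<bar>"] by simp
    moreover have "0 \<le> \<bar>f x\<bar> * \<bar>g x\<bar>" by simp
    ultimately have "\<bar>f x\<bar> * \<bar>g x\<bar> \<le> (f x)\<^sup>2 + (g x)\<^sup>2" by linarith
    then show "norm (f x * g x) \<le> norm ((f x)\<^sup>2 + (g x)\<^sup>2)"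
      by (simp add: abs_mult)
  qed
qed simp

lemma poly_eq_synthetic_div:
  fixes p :: "'a::comm_ring_1 poly"
  shows "p = [:poly p a:] + [:- a, 1:] * synthetic_div p a"
  using synthetic_div_correct'[of a p] by (simp add: add.commute)

text \<open>Division by a linear factor lowers the degree by one. Bounding coefficients instead of
  \<open>degree\<close> also covers \<open>n = 0\<close>, where the quotient is zero although its
  \<open>degree\<close> is again 0.\<close>

lemma coeff_synthetic_div_eq_0:
  assumes "\<And>i. i > n \<Longrightarrow> coeff p i = 0" and "i \<ge> n"
  shows "coeff (synthetic_div p a) i = 0"
proof (cases "degree p = 0")
  case True
  then show ?thesis by (simp add: synthetic_div_eq_0_iff[THEN iffD2])
next
  case False
  have "degree p \<le> n" using assms(1) by (intro degree_le) auto
  with False have "degree (synthetic_div p a) < n" by (simp add: degree_synthetic_div)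
  with assms(2) show ?thesis by (intro coeff_eq_0) simp
qed

section \<open>The inner product space of real polynomials\<close>

text \<open>These properties pass from \<mu> to \<mu> weighted by \<open>x ^ (2 * k)\<close>, as the
  induction on \<open>k\<close> requires. Total mass 1 would not pass; only finiteness is kept, and
  it follows from square integrability of the polynomial 1.\<close>

locale positive_moments =
  fixes M :: "real measure"
  assumes sets_M [measurable_cong]: "sets M = sets borel"
    and AE_pos: "AE x in M. 0 < x"
    and poly_square_integrable: "\<And>p :: real poly. integrable M (\<lambda>x. (poly p x)\<^sup>2)"
    and near_zero: "\<And>\<delta>. 0 < \<delta> \<Longrightarrow> emeasure M {0<..<\<delta>} > 0"
begin

lemma measurable_poly [measurable]: "poly p \<in> borel_measurable M" for p :: "real poly"
  unfolding measurable_cong_sets[OF sets_M refl]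
  by (intro borel_measurable_continuous_onI continuous_intros)

definition ip :: "real poly \<Rightarrow> real poly \<Rightarrow> real" where
  "ip p q = (\<integral>x. poly p x * poly q x \<partial>M)"

lemma integrable_poly_mult: "integrable M (\<lambda>x. poly p x * poly q x)" for p q :: "real poly"
  by (intro integrable_mult_of_squares poly_square_integrable) measurable

lemma finite_M: "finite_measure M"
proof -
  have "integrable M (\<lambda>x. 1 :: real)" using poly_square_integrable[of 1] by simp
  then show ?thesis by (intro finite_measureI) (simp add: integrable_iff_bounded less_top)
qed

sublocale finite_measure M by (rule finite_M)

lemma ip_diff_left: "ip (p - r) q = ip p q - ip r q"
  unfolding ip_def by (simp add: ring_distribs integrable_poly_mult left_diff_distrib)

lemma ip_smult_left: "ip (smult c p) q = c * ip p q"
  unfolding ip_def by (simp add: mult.assoc)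

lemma ip_commute: "ip p q = ip q p"
  unfolding ip_def by (simp add: mult.commute)

lemma ip_sum_left: "ip (\<Sum>k\<in>A. f k) q = (\<Sum>k\<in>A. ip (f k) q)"
  unfolding ip_def by (simp add: poly_sum sum_distrib_right integrable_poly_mult)

lemma ip_sum_right: "ip q (\<Sum>k\<in>A. f k) = (\<Sum>k\<in>A. ip q (f k))"
  by (simp only: ip_commute[of q] ip_sum_left)

lemma ip_smult_right: "ip p (smult c q) = c * ip p q"
  by (metis ip_commute ip_smult_left)

lemma ip_self: "ip p p = (\<integral>x. (poly p x)\<^sup>2 \<partial>M)"
  unfolding ip_def by (simp add: power2_eq_square)

lemma ip_self_nonneg: "0 \<le> ip p p"
  unfolding ip_self by simp

text \<open>A nonzero polynomial has finitely many roots, so some interval \<open>{0<..<d}\<close>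
  contains none of them, and \<open>near_zero\<close> gives that interval positive mass.
  Gram-Schmidt divides by these values.\<close>

lemma ip_self_pos:
  assumes "p \<noteq> 0"
  shows "0 < ip p p"
proof (rule ccontr)
  assume "\<not> 0 < ip p p"
  then have "(\<integral>x. (poly p x)\<^sup>2 \<partial>M) = 0" using ip_self_nonneg[of p] ip_self[of p]
    by linarith
  then have ae: "AE x in M. poly p x = 0"
    using integral_nonneg_eq_0_iff_AE[OF poly_square_integrable[of p]] by simp
  \<comment> \<open>The element 1 keeps \<open>R\<close> nonempty, so that \<open>Min R\<close>
    makes sense even without positive roots.\<close>
  define R where "R = insert 1 {x. poly p x = 0 \<and> 0 < x}"
  have fin: "finite R" unfolding R_def using poly_roots_finite[OF assms] by simp
  define d where "d = Min R"
  have "d > 0" unfolding d_def using fin by (subst Min_gr_iff) (auto simp: R_def)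
  have "AE x in M. x \<notin> {0<..<d}"
    using ae
  proof eventually_elim
    case (elim x)
    show ?case
    proof
      assume x: "x \<in> {0<..<d}"
      with elim have "x \<in> R" by (simp add: R_def)
      then have "d \<le> x" unfolding d_def using fin by simp
      with x show False by simp
    qed
  qed
  then have "emeasure M {0<..<d} = 0"
    by (subst (asm) AE_iff_measurable[of "{0<..<d}"]) (auto simp: sets_M sets_eq_imp_space_eq[OF sets_M])
  with near_zero[OF \<open>d > 0\<close>] show False by simp
qed

section \<open>Orthonormal polynomials\<close>

text \<open>Gram-Schmidt applied to the monomials, with normalization postponed to
  \<open>onp\<close> so that the leading coefficients stay 1.\<close>

fun monic_op :: "nat \<Rightarrow> real poly" where
  "monic_op n = monom 1 n -
     (\<Sum>k<n. smult (ip (monom 1 n) (monic_op k) / ip (monic_op k) (monic_op k)) (monic_op k))"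

declare monic_op.simps [simp del]

lemma coeff_monic_op: "coeff (monic_op n) n = 1 \<and> (\<forall>i>n. coeff (monic_op n) i = 0)"
proof (induction n rule: less_induct)
  case (less n)
  then show ?case
    by (subst (1 2) monic_op.simps) (auto simp: coeff_sum intro!: sum.neutral)
qed

lemma monic_op_pos: "0 < ip (monic_op n) (monic_op n)"
  using coeff_monic_op[of n] by (intro ip_self_pos) auto

text \<open>Among the projections subtracted from \<open>monom 1 n\<close>, only the one along
  \<open>monic_op m\<close> has a nonzero product with \<open>monic_op m\<close>, and it cancels
  that of \<open>monom 1 n\<close>.\<close>

lemma monic_op_orthogonal_less: "m < n \<Longrightarrow> ip (monic_op n) (monic_op m) = 0"
proof (induction n arbitrary: m rule: less_induct)
  case (less n)
  have "ip (monic_op k) (monic_op m) = 0" if "k < n" "k \<noteq> m" for k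
    using less.IH[of k m] less.IH[of m k] less.prems that ip_commute by (metis linorder_neqE_nat)
  then have "(\<Sum>k<n. ip (monom 1 n) (monic_op k) / ip (monic_op k) (monic_op k) * ip (monic_op k) (monic_op m))
     = (\<Sum>k\<in>{m}. ip (monom 1 n) (monic_op k) / ip (monic_op k) (monic_op k) * ip (monic_op k) (monic_op m))"
    using less.prems by (intro sum.mono_neutral_right) auto
  then show ?case using monic_op_pos[of m]
    by (subst monic_op.simps) (simp add: ip_diff_left ip_sum_left ip_smult_left)
qed

definition onp :: "nat \<Rightarrow> real poly" where
  "onp n = smult (1 / sqrt (ip (monic_op n) (monic_op n))) (monic_op n)"

lemma onp_orthonormal: "ip (onp n) (onp m) = (if n = m then 1 else 0)"
proof -
  consider "n = m" | "n < m" | "m < n" by linarith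
  then show ?thesis
  proof cases
    case 1
    have "sqrt (ip (monic_op m) (monic_op m)) * sqrt (ip (monic_op m) (monic_op m)) = ip (monic_op m) (monic_op m)"
      using ip_self_nonneg by simp
    with 1 monic_op_pos[of m] show ?thesis
      by (simp add: onp_def ip_smult_left ip_smult_right)
  next
    case 2
    then show ?thesis
      using monic_op_orthogonal_less[of n m] ip_commute[of "monic_op n" "monic_op m"]
      by (simp add: onp_def ip_smult_left ip_smult_right)
  next
    case 3
    then show ?thesis
      using monic_op_orthogonal_less[of m n] by (simp add: onp_def ip_smult_left ip_smult_right)
  qed
qed

lemma coeff_onp: "coeff (onp n) n \<noteq> 0" "i > n \<Longrightarrow> coeff (onp n) i = 0"
  using coeff_monic_op[of n] monic_op_pos[of n] by (auto simp: onp_def)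

text \<open>Induction removes the leading term with a multiple of \<open>onp n\<close>. The
  hypothesis says that the degree is below \<open>n\<close>; for \<open>n = 0\<close> it leaves the
  zero polynomial.\<close>

lemma onp_expansion:
  "(\<And>i. i \<ge> n \<Longrightarrow> coeff p i = 0) \<Longrightarrow> \<exists>c. p = (\<Sum>k<n. smult (c k) (onp k))"
proof (induction n arbitrary: p)
  case 0
  then show ?case by (auto intro: poly_eqI)
next
  case (Suc n)
  define b where "b = coeff p n / coeff (onp n) n"
  have "coeff (p - smult b (onp n)) i = 0" if "i \<ge> n" for i
    using that Suc.prems[of i] coeff_onp[of n] coeff_onp(2)[of n i]
    by (cases "i = n") (auto simp: b_def)
  from Suc.IH[OF this] obtain c where c: "p - smult b (onp n) = (\<Sum>k<n. smult (c k) (onp k))"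
    by blast
  have "p = (\<Sum>k<Suc n. smult ((c(n := b)) k) (onp k))"
    using c by (simp add: algebra_simps)
  then show ?case by blast
qed

text \<open>Parseval's identity for finite expansions.\<close>

lemma ip_expansion:
  "ip (\<Sum>k<n. smult (c k) (onp k)) (\<Sum>k<n. smult (c k) (onp k)) = (\<Sum>k<n. (c k)\<^sup>2)"
  by (simp add: ip_sum_left ip_sum_right ip_smult_left ip_smult_right onp_orthonormal
      if_distrib[of "\<lambda>y. _ * y"] power2_eq_square sum.delta cong: if_cong)

lemma onp_orthogonal_lower:
  assumes "\<And>i. i \<ge> n \<Longrightarrow> coeff q i = 0"
  shows "ip (onp n) q = 0"
proof -
  obtain c where "q = (\<Sum>k<n. smult (c k) (onp k))" using onp_expansion assms by blast
  then show ?thesis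
    by (simp add: ip_sum_right ip_smult_right onp_orthonormal)
qed


section \<open>Moving bounded evaluation from 0 to a negative point\<close>

text \<open>Write \<open>p = a + (x + t) * q\<close> with \<open>a = poly p (- t)\<close>. Then
  \<open>a\<close> is \<open>poly p 0\<close> minus the value of \<open>t * q\<close> at 0, and
  \<open>t * q\<close> equals \<open>t / (x + t)\<close> times \<open>p - a\<close>. Its norm is
  thus controlled by that of \<open>p\<close> and by \<open>a\<close> times the norm of
  \<open>t / (x + t)\<close>, which is small for small \<open>t\<close>.\<close>

lemma eval_neg_bounded:
  assumes C: "\<And>p. (poly p 0)\<^sup>2 \<le> C * ip p p"
  shows "\<exists>t>0. \<exists>K. \<forall>p. (poly p (- t))\<^sup>2 \<le> K * ip p p"
proof -
  have C0: "0 < C"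
  proof (rule ccontr)
    assume "\<not> 0 < C"
    then have "C * ip 1 1 \<le> 0" using ip_self_nonneg[of 1] by (intro mult_nonpos_nonneg) auto
    with C[of 1] show False by simp
  qed
  \<comment> \<open>The candidates for \<open>t\<close> are \<open>1 / (m + 1)\<close>. The
    integrands are at most 1 and tend to 0 at every positive \<open>x\<close>, hence almost
    everywhere.\<close>
  have "(\<lambda>m. \<integral>x. (inverse (real (Suc m)) / (x + inverse (real (Suc m))))\<^sup>2 \<partial>M) \<longlonglongrightarrow> (\<integral>x. 0 \<partial>M)"
  proof (rule integral_dominated_convergence[where w = "\<lambda>_. 1"])
    show "AE x in M. (\<lambda>m. (inverse (real (Suc m)) / (x + inverse (real (Suc m))))\<^sup>2) \<longlonglongrightarrow> 0"
      using AE_pos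
    proof eventually_elim
      case (elim x)
      have "(\<lambda>m. (inverse (real (Suc m)) / (x + inverse (real (Suc m))))\<^sup>2) \<longlonglongrightarrow> (0 / (x + 0))\<^sup>2"
        using elim by (intro tendsto_power tendsto_divide tendsto_add tendsto_const LIMSEQ_inverse_real_of_nat) auto
      then show ?case by simp
    qed
    fix m
    show "AE x in M. norm ((inverse (real (Suc m)) / (x + inverse (real (Suc m))))\<^sup>2) \<le> 1"
      using AE_pos
    proof eventually_elim
      case (elim x)
      have "norm ((s / (x + s))\<^sup>2) \<le> 1" if "0 < s" for s
        using elim that by (simp add: power_le_one)
      then show ?case by simp
    qed
  qed (auto)
  \<comment> \<open>The factor \<open>4 * C\<close> is the one that accompanies
    \<open>a\<^sup>2 * I\<close> in the final estimate; a product below 1/2 lets that term be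
    absorbed on the left.\<close>
  then have "(\<lambda>m. 4 * C * (\<integral>x. (inverse (real (Suc m)) / (x + inverse (real (Suc m))))\<^sup>2 \<partial>M)) \<longlonglongrightarrow> 4 * C * (\<integral>x. 0 \<partial>M)"
    by (intro tendsto_mult tendsto_const)
  then have "\<forall>\<^sub>F m in sequentially. 4 * C * (\<integral>x. (inverse (real (Suc m)) / (x + inverse (real (Suc m))))\<^sup>2 \<partial>M) < 1/2"
    by (rule order_tendstoD) simp
  then obtain m where m: "4 * C * (\<integral>x. (inverse (real (Suc m)) / (x + inverse (real (Suc m))))\<^sup>2 \<partial>M) < 1/2"
    by (auto dest: eventually_happens)
  define t where "t = inverse (real (Suc m))"
  have t: "t > 0" unfolding t_def by simp
  define I where "I = (\<integral>x. (t / (x + t))\<^sup>2 \<partial>M)"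
  have I: "4 * C * I < 1/2" using m unfolding I_def t_def .
  have s01: "AE x in M. 0 \<le> t / (x + t) \<and> t / (x + t) \<le> 1"
    using AE_pos by eventually_elim (use t in auto)
  have s2: "AE x in M. (t / (x + t))\<^sup>2 \<le> 1"
    using s01 by eventually_elim (simp add: power_le_one)
  have int_s: "integrable M (\<lambda>x. (t / (x + t))\<^sup>2)"
    by (rule integrable_const_bound[where B = 1]) (use s2 in \<open>auto\<close>)
  have "(poly p (- t))\<^sup>2 \<le> 12 * C * ip p p" for p
  proof -
    define a where "a = poly p (- t)"
    define q where "q = synthetic_div p (- t)"
    have q: "p = [:a:] + [:t, 1:] * q"
      using poly_eq_synthetic_div[of p "- t"] unfolding a_def q_def by simp
    have "(\<integral>x. (t * poly q x)\<^sup>2 \<partial>M) \<le> (\<integral>x. 2 * (poly p x)\<^sup>2 + 2 * a\<^sup>2 * (t / (x + t))\<^sup>2 \<partial>M)"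
    proof (rule integral_mono_AE)
      show "integrable M (\<lambda>x. (t * poly q x)\<^sup>2)"
        using poly_square_integrable[of "smult t q"] by simp
      show "integrable M (\<lambda>x. 2 * (poly p x)\<^sup>2 + 2 * a\<^sup>2 * (t / (x + t))\<^sup>2)"
        using poly_square_integrable int_s by simp
      show "AE x in M. (t * poly q x)\<^sup>2 \<le> 2 * (poly p x)\<^sup>2 + 2 * a\<^sup>2 * (t / (x + t))\<^sup>2"
        using AE_pos s2
      proof eventually_elim
        case (elim x)
        define s where "s = t / (x + t)"
        have "poly p x = a + (t + x) * poly q x" by (subst q) (simp add: algebra_simps)
        then have "t * poly q x = s * (poly p x - a)"
          using elim t unfolding s_def by (simp add: field_simps)
        then have "(t * poly q x)\<^sup>2 = s\<^sup>2 * (poly p x - a)\<^sup>2" by (simp add: power_mult_distrib)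
        also have "\<dots> \<le> s\<^sup>2 * (2 * (poly p x)\<^sup>2 + 2 * a\<^sup>2)"
          by (intro mult_left_mono power2_diff_le) simp
        also have "\<dots> = s\<^sup>2 * (2 * (poly p x)\<^sup>2) + 2 * a\<^sup>2 * s\<^sup>2" by (simp add: algebra_simps)
        also have "s\<^sup>2 * (2 * (poly p x)\<^sup>2) \<le> 2 * (poly p x)\<^sup>2"
          using elim unfolding s_def by (intro mult_left_le_one_le) auto
        finally show ?case by (simp add: s_def)
      qed
    qed
    also have "\<dots> = 2 * ip p p + 2 * a\<^sup>2 * I"
      using poly_square_integrable int_s by (simp add: ip_self I_def)
    finally have q_le: "ip (smult t q) (smult t q) \<le> 2 * ip p p + 2 * a\<^sup>2 * I"
      by (simp add: ip_self)
    have "poly p 0 = a + t * poly q 0" by (subst q) simp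
    then have "a = poly p 0 - poly (smult t q) 0" by simp
    then have "a\<^sup>2 \<le> 2 * (poly p 0)\<^sup>2 + 2 * (poly (smult t q) 0)\<^sup>2"
      using power2_diff_le by metis
    also have "\<dots> \<le> 2 * (C * ip p p) + 2 * (C * ip (smult t q) (smult t q))"
      using C[of p] C[of "smult t q"] by linarith
    also have "\<dots> \<le> 2 * (C * ip p p) + 2 * (C * (2 * ip p p + 2 * a\<^sup>2 * I))"
      using q_le C0 by simp
    also have "\<dots> = 6 * (C * ip p p) + a\<^sup>2 * (4 * C * I)" by (simp add: algebra_simps)
    also have "a\<^sup>2 * (4 * C * I) \<le> a\<^sup>2 * (1/2)" using I by (intro mult_left_mono) auto
    finally show ?thesis unfolding a_def by simp
  qed
  with t show ?thesis by blast
qed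

section \<open>The trace of multiplication by \<open>1 / (x + t)\<close>\<close>

lemma integrable_resolvent:
  fixes f :: "real \<Rightarrow> real"
  assumes "integrable M f" "0 < t"
  shows "integrable M (\<lambda>x. f x / (x + t))"
proof (rule Bochner_Integration.integrable_bound)
  show "integrable M (\<lambda>x. f x / t)" using assms by simp
  have "f \<in> borel_measurable M" using assms by simp
  then show "(\<lambda>x. f x / (x + t)) \<in> borel_measurable M" by measurable
  show "AE x in M. norm (f x / (x + t)) \<le> norm (f x / t)"
    using AE_pos
  proof eventually_elim
    case (elim x)
    then show ?case using assms(2)
      by (auto simp: abs_divide intro!: divide_left_mono mult_pos_pos)
  qed
qed

lemma integrable_poly: "integrable M (poly p)" for p :: "real poly"
  using integrable_poly_mult[of p 1] by simp

text \<open>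
  Subtracting \<open>poly (onp k) (- t)\<close> from one factor of \<open>(poly (onp k) x)\<^sup>2 / (x + t)\<close> leaves
  \<open>onp k\<close> times a polynomial of lower degree, so the \<open>k\<close>-th diagonal entry of the positive
  operator of multiplication by \<open>1 / (x + t)\<close> is a product of two square summable sequences.
\<close>
lemma resolvent_trace_bounded:
  assumes t: "0 < t" and K: "\<And>p. (poly p (- t))\<^sup>2 \<le> K * ip p p"
  shows "\<exists>B. \<forall>n. (\<Sum>k<n. \<integral>x. (poly (onp k) x)\<^sup>2 / (x + t) \<partial>M) \<le> B"
proof -
  define b where "b k = poly (onp k) (- t)" for k
  define c where "c k = (\<integral>x. poly (onp k) x / (x + t) \<partial>M)" for k
  define U where "U = (\<integral>x. (1 / (x + t))\<^sup>2 \<partial>M)"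
  have diag: "(\<integral>x. (poly (onp k) x)\<^sup>2 / (x + t) \<partial>M) = b k * c k" for k
  proof -
    define q where "q = synthetic_div (onp k) (- t)"
    have q: "onp k = [:b k:] + [:t, 1:] * q"
      using poly_eq_synthetic_div[of "onp k" "- t"] unfolding b_def q_def by simp
    have "coeff q i = 0" if "i \<ge> k" for i
      unfolding q_def using coeff_onp(2) that by (rule coeff_synthetic_div_eq_0)
    then have orth: "ip (onp k) q = 0" by (rule onp_orthogonal_lower)
    have "(\<integral>x. (poly (onp k) x)\<^sup>2 / (x + t) \<partial>M)
        = (\<integral>x. b k * (poly (onp k) x / (x + t)) + poly (onp k) x * poly q x \<partial>M)"
    proof (rule integral_cong_AE)
      show "AE x in M. (poly (onp k) x)\<^sup>2 / (x + t)
          = b k * (poly (onp k) x / (x + t)) + poly (onp k) x * poly q x"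
        using AE_pos
      proof eventually_elim
        case (elim x)
        have "poly (onp k) x = b k + (t + x) * poly q x" by (subst q) (simp add: algebra_simps)
        then have "(poly (onp k) x)\<^sup>2 = poly (onp k) x * (b k + (t + x) * poly q x)"
          by (simp add: power2_eq_square)
        then show ?case using elim t by (simp add: field_simps)
      qed
    qed measurable
    also have "\<dots> = b k * c k + ip (onp k) q"
      unfolding c_def ip_def
      by (subst Bochner_Integration.integral_add)
        (auto simp del: times_divide_eq_right
          intro!: integrable_poly_mult integrable_resolvent[OF integrable_poly t])
    finally show ?thesis using orth by simp
  qed
  have "(\<Sum>k<n. b k * c k) \<le> (K + U) / 2" for n
  proof -
    \<comment> \<open>The bound \<open>K\<close> is tested on the truncated reproducing kernel at
      \<open>- t\<close>, the sum of the \<open>smult (b k) (onp k)\<close>: its value at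
      \<open>- t\<close> and its squared norm are both \<open>S\<close>.\<close>
    have b_sum: "(\<Sum>k<n. (b k)\<^sup>2) \<le> K"
    proof -
      define S where "S = (\<Sum>k<n. (b k)\<^sup>2)"
      have "S\<^sup>2 \<le> K * S"
        using K[of "\<Sum>k<n. smult (b k) (onp k)"] unfolding ip_expansion
        by (simp add: poly_sum S_def b_def power2_eq_square)
      moreover have "S \<ge> 0" unfolding S_def by (simp add: sum_nonneg)
      moreover have "K \<ge> 0" using K[of "onp 0"] onp_orthonormal[of 0 0]
        by (simp add: order_trans[OF zero_le_power2])
      ultimately have "S \<le> K"
        by (cases "S = 0") (auto simp: power2_eq_square)
      then show ?thesis unfolding S_def .
    qed
    \<comment> \<open>Bessel's inequality: the \<open>c k\<close> are the Fourier coefficients of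
      \<open>1 / (x + t)\<close>, and \<open>U\<close> is its squared norm.\<close>
    have c_sum: "(\<Sum>k<n. (c k)\<^sup>2) \<le> U"
    proof -
      define p where "p = (\<Sum>k<n. smult (c k) (onp k))"
      have int_u: "integrable M (\<lambda>x. (1 / (x + t))\<^sup>2)"
        using integrable_resolvent[OF integrable_resolvent[OF integrable_const t] t, of 1]
        by (simp add: power2_eq_square)
      have int_up: "integrable M (\<lambda>x. poly p x / (x + t))"
        by (rule integrable_resolvent[OF integrable_poly t])
      have up: "(\<integral>x. poly p x / (x + t) \<partial>M) = (\<Sum>k<n. (c k)\<^sup>2)"
      proof -
        have "poly p x / (x + t) = (\<Sum>k<n. c k * (poly (onp k) x / (x + t)))" for x
          by (simp add: p_def poly_sum sum_divide_distrib)
        then have "(\<integral>x. poly p x / (x + t) \<partial>M)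
            = (\<Sum>k<n. \<integral>x. c k * (poly (onp k) x / (x + t)) \<partial>M)"
          by (simp del: times_divide_eq_right
              add: Bochner_Integration.integral_sum integrable_resolvent[OF integrable_poly t])
        then show ?thesis by (simp del: times_divide_eq_right add: power2_eq_square flip: c_def)
      qed
      have "0 \<le> (\<integral>x. (1 / (x + t) - poly p x)\<^sup>2 \<partial>M)" by simp
      also have "\<dots> = (\<integral>x. (1 / (x + t))\<^sup>2 - 2 * (poly p x / (x + t)) + (poly p x)\<^sup>2 \<partial>M)"
        by (rule Bochner_Integration.integral_cong) (auto simp: power2_eq_square algebra_simps)
      also have "\<dots> = U - 2 * (\<Sum>k<n. (c k)\<^sup>2) + ip p p"
        using int_u int_up poly_square_integrable[of p] up
        by (simp add: U_def ip_self del: times_divide_eq_right)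
      also have "ip p p = (\<Sum>k<n. (c k)\<^sup>2)" unfolding p_def by (rule ip_expansion)
      finally show ?thesis by simp
    qed
    have "(\<Sum>k<n. b k * c k) \<le> (\<Sum>k<n. ((b k)\<^sup>2 + (c k)\<^sup>2) / 2)"
    proof (intro sum_mono)
      show "b k * c k \<le> ((b k)\<^sup>2 + (c k)\<^sup>2) / 2" for k
        using sum_squares_bound[of "b k" "c k"] by simp
    qed
    also have "\<dots> = ((\<Sum>k<n. (b k)\<^sup>2) + (\<Sum>k<n. (c k)\<^sup>2)) / 2"
      by (simp add: sum.distrib flip: sum_divide_distrib)
    finally show ?thesis using b_sum c_sum by simp
  qed
  then show ?thesis unfolding diag by blast
qed

section \<open>Uniformly small mass of polynomials near 0\<close>

text \<open>By Cauchy-Schwarz, the integral of the square of \<open>p\<close> over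
  \<open>{0<..<d}\<close> is at most \<open>ip p p\<close> times the sum of the masses of the
  squared \<open>onp k\<close> there. The finite trace makes the tail of this sum small uniformly in
  \<open>d \<le> 1\<close>; the remaining finitely many terms vanish as \<open>d\<close> tends to
  0.\<close>

lemma small_mass_near_zero:
  assumes t: "0 < t" and B: "\<And>n. (\<Sum>k<n. \<integral>x. (poly (onp k) x)\<^sup>2 / (x + t) \<partial>M) \<le> B"
    and \<eta>: "0 < \<eta>"
  shows "\<exists>\<delta>>0. \<forall>p. (\<integral>x. indicator {0<..<\<delta>} x * (poly p x)\<^sup>2 \<partial>M) \<le> \<eta> * ip p p"
proof -
  have int_ind: "integrable M (\<lambda>x. indicator {0<..<d} x * (poly p x)\<^sup>2)" for d :: real and p
    using integrable_real_mult_indicator[OF _ poly_square_integrable[of p], of "{0<..<d}"]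
    by (simp add: sets_M mult.commute)
  define a where "a k = (\<integral>x. indicator {0<..<1} x * (poly (onp k) x)\<^sup>2 \<partial>M)" for k
  \<comment> \<open>On \<open>{0<..<1}\<close> the weight \<open>1 / (x + t)\<close> is at least
    \<open>1 / (1 + t)\<close>.\<close>
  have a_le: "a k \<le> (1 + t) * (\<integral>x. (poly (onp k) x)\<^sup>2 / (x + t) \<partial>M)" for k
  proof -
    have "a k \<le> (\<integral>x. (1 + t) * ((poly (onp k) x)\<^sup>2 / (x + t)) \<partial>M)"
      unfolding a_def
    proof (rule integral_mono_AE)
      show "integrable M (\<lambda>x. (1 + t) * ((poly (onp k) x)\<^sup>2 / (x + t)))"
        by (intro integrable_mult_right integrable_resolvent[OF poly_square_integrable t])
      show "AE x in M. indicator {0<..<1} x * (poly (onp k) x)\<^sup>2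
          \<le> (1 + t) * ((poly (onp k) x)\<^sup>2 / (x + t))"
        using AE_pos
      proof eventually_elim
        case (elim x)
        show ?case
        proof (cases "x < 1")
          case True
          then have "1 \<le> (1 + t) / (x + t)" using elim t by simp
          then have "1 * (poly (onp k) x)\<^sup>2 \<le> (1 + t) / (x + t) * (poly (onp k) x)\<^sup>2"
            by (intro mult_right_mono) auto
          with True elim show ?thesis by simp
        qed (use elim t in auto)
      qed
    qed (rule int_ind)
    then show ?thesis by (simp del: times_divide_eq_right)
  qed
  have a0: "0 \<le> a k" for k unfolding a_def by simp
  have "summable a"
  proof (rule summableI_nonneg_bounded[where x = "(1 + t) * B"])
    fix n
    have "(\<Sum>k<n. a k) \<le> (1 + t) * (\<Sum>k<n. \<integral>x. (poly (onp k) x)\<^sup>2 / (x + t) \<partial>M)"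
      unfolding sum_distrib_left by (intro sum_mono a_le)
    also have "\<dots> \<le> (1 + t) * B" using B t by (intro mult_left_mono) auto
    finally show "(\<Sum>k<n. a k) \<le> (1 + t) * B" .
  qed (rule a0)
  then obtain N where N: "\<And>n. norm (sum a {N..<n}) < \<eta> / 2"
    using \<eta> unfolding summable_Cauchy by (meson half_gt_zero order_refl)
  \<comment> \<open>The intervals omit 0 and shrink to the empty set, so the integrand is eventually
    0 at every point.\<close>
  have "(\<lambda>m. \<integral>x. indicator {0<..<inverse (real (Suc m))} x * (\<Sum>k<N. (poly (onp k) x)\<^sup>2) \<partial>M)
      \<longlonglongrightarrow> (\<integral>x. 0 \<partial>M)"
  proof (rule integral_dominated_convergence[where w = "\<lambda>x. \<Sum>k<N. (poly (onp k) x)\<^sup>2"])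
    show "AE x in M. (\<lambda>m. indicator {0<..<inverse (real (Suc m))} x * (\<Sum>k<N. (poly (onp k) x)\<^sup>2)) \<longlonglongrightarrow> 0"
    proof (rule AE_I2)
      fix x :: real
      have "\<forall>\<^sub>F m in sequentially. indicator {0<..<inverse (real (Suc m))} x * (\<Sum>k<N. (poly (onp k) x)\<^sup>2) = 0"
      proof (cases "0 < x")
        case True
        with order_tendstoD(2)[OF LIMSEQ_inverse_real_of_nat True] show ?thesis
          by (auto elim: eventually_mono)
      qed auto
      then show "(\<lambda>m. indicator {0<..<inverse (real (Suc m))} x * (\<Sum>k<N. (poly (onp k) x)\<^sup>2)) \<longlonglongrightarrow> 0"
        by (rule tendsto_eventually)
    qed
  qed (auto simp: poly_square_integrable indicator_def sum_nonneg abs_of_nonneg sets_M)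
  then have "\<forall>\<^sub>F m in sequentially.
      (\<integral>x. indicator {0<..<inverse (real (Suc m))} x * (\<Sum>k<N. (poly (onp k) x)\<^sup>2) \<partial>M) < \<eta> / 2"
    by (rule order_tendstoD) (use \<eta> in simp)
  then obtain m where m: "(\<integral>x. indicator {0<..<inverse (real (Suc m))} x * (\<Sum>k<N. (poly (onp k) x)\<^sup>2) \<partial>M) < \<eta> / 2"
    by (auto dest: eventually_happens)
  define d where "d = inverse (real (Suc m))"
  have d: "0 < d" "d \<le> 1" unfolding d_def by (auto simp: inverse_le_1_iff)
  define e where "e k = (\<integral>x. indicator {0<..<d} x * (poly (onp k) x)\<^sup>2 \<partial>M)" for k
  have e_low: "(\<Sum>k<N. e k) < \<eta> / 2"
  proof -
    have "(\<Sum>k<N. e k) = (\<integral>x. (\<Sum>k<N. indicator {0<..<d} x * (poly (onp k) x)\<^sup>2) \<partial>M)"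
      unfolding e_def by (rule Bochner_Integration.integral_sum[symmetric]) (rule int_ind)
    with m show ?thesis unfolding sum_distrib_left d_def by simp
  qed
  have e_le: "e k \<le> a k" for k
    unfolding e_def a_def using d by (intro integral_mono int_ind) (auto simp: indicator_def)
  have "(\<integral>x. indicator {0<..<d} x * (poly p x)\<^sup>2 \<partial>M) \<le> \<eta> * ip p p" for p
  proof -
    \<comment> \<open>Large enough both to expand \<open>p\<close> and to split the sum at
      \<open>N\<close>.\<close>
    define n where "n = max N (Suc (degree p))"
    obtain c where c: "p = (\<Sum>k<n. smult (c k) (onp k))"
      using onp_expansion[of n p] coeff_eq_0[of p] unfolding n_def by (auto simp: Suc_le_eq)
    have ipp: "ip p p = (\<Sum>k<n. (c k)\<^sup>2)" unfolding c by (rule ip_expansion)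
    have "(\<integral>x. indicator {0<..<d} x * (poly p x)\<^sup>2 \<partial>M)
        \<le> (\<integral>x. ip p p * (\<Sum>k<n. indicator {0<..<d} x * (poly (onp k) x)\<^sup>2) \<partial>M)"
    proof (rule integral_mono)
      fix x :: real
      have "(poly p x)\<^sup>2 \<le> ip p p * (\<Sum>k<n. (poly (onp k) x)\<^sup>2)"
        unfolding ipp using Cauchy_Schwarz_ineq_sum[of c "\<lambda>k. poly (onp k) x" "{..<n}"]
        by (subst (1) c) (simp add: poly_sum)
      then have "indicator {0<..<d} x * (poly p x)\<^sup>2
          \<le> indicator {0<..<d} x * (ip p p * (\<Sum>k<n. (poly (onp k) x)\<^sup>2))"
        by (rule mult_left_mono) simp
      then show "indicator {0<..<d} x * (poly p x)\<^sup>2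
          \<le> ip p p * (\<Sum>k<n. indicator {0<..<d} x * (poly (onp k) x)\<^sup>2)"
        by (simp only: sum_distrib_left mult.left_commute)
    qed (intro integrable_mult_right Bochner_Integration.integrable_sum int_ind)+
    also have "\<dots> = ip p p * (\<Sum>k<n. e k)"
      unfolding e_def integral_mult_right_zero by (subst Bochner_Integration.integral_sum) (rule int_ind refl)+
    also have "(\<Sum>k<n. e k) = (\<Sum>k<N. e k) + sum e {N..<n}"
      unfolding n_def lessThan_atLeast0 by (rule sum.atLeastLessThan_concat[symmetric]) auto
    also have "ip p p * \<dots> \<le> ip p p * \<eta>"
    proof (rule mult_left_mono[OF _ ip_self_nonneg])
      have "sum e {N..<n} \<le> sum a {N..<n}" by (intro sum_mono e_le)
      with N[of n] e_low show "(\<Sum>k<N. e k) + sum e {N..<n} \<le> \<eta>" by simp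
    qed
    finally show ?thesis by (simp add: mult.commute)
  qed
  with d(1) show ?thesis by blast
qed

section \<open>Polynomials of small norm with value 1 at 0\<close>

text \<open>If the norms stayed away from 0, rescaling would bound evaluation at 0, and the
  preceding lemmas would make every polynomial small near 0. A polynomial close to an indicator
  function there contradicts this.\<close>

lemma small_poly_normalized_at_zero:
  assumes approx: "\<And>\<delta> \<epsilon>. 0 < \<delta> \<Longrightarrow> 0 < \<epsilon> \<Longrightarrow>
      \<exists>p. (\<integral>x. (indicator {0<..<\<delta>} x - poly p x)\<^sup>2 \<partial>M) < \<epsilon>"
    and "0 < \<epsilon>"
  shows "\<exists>p. poly p 0 = 1 \<and> (\<integral>x. (poly p x)\<^sup>2 \<partial>M) < \<epsilon>"
proof (rule ccontr)
  assume "\<not> ?thesis"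
  then have large: "\<epsilon> \<le> ip p p" if "poly p 0 = 1" for p
    using that by (auto simp: ip_self not_less)
  have "(poly p 0)\<^sup>2 \<le> 1 / \<epsilon> * ip p p" for p
  proof (cases "poly p 0 = 0")
    case True
    then show ?thesis using \<open>0 < \<epsilon>\<close> ip_self_nonneg[of p] by simp
  next
    case False
    then have "\<epsilon> \<le> (1 / poly p 0)\<^sup>2 * ip p p"
      using large[of "smult (1 / poly p 0) p"]
      by (simp add: ip_smult_left ip_smult_right power2_eq_square)
    with False \<open>0 < \<epsilon>\<close> show ?thesis by (simp add: field_simps)
  qed
  then obtain t K where t: "0 < t" and "\<And>p. (poly p (- t))\<^sup>2 \<le> K * ip p p"
    using eval_neg_bounded by blast
  then obtain B where "\<And>n. (\<Sum>k<n. \<integral>x. (poly (onp k) x)\<^sup>2 / (x + t) \<partial>M) \<le> B"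
    using resolvent_trace_bounded by blast
  from small_mass_near_zero[OF t this, of "1/8"] obtain \<delta> where \<delta>: "0 < \<delta>"
    and small: "\<And>p. (\<integral>x. indicator {0<..<\<delta>} x * (poly p x)\<^sup>2 \<partial>M) \<le> 1/8 * ip p p"
    by auto
  define g :: "real \<Rightarrow> real" where "g = indicator {0<..<\<delta>}"
  define m where "m = measure M {0<..<\<delta>}"
  have m: "0 < m" using near_zero[OF \<delta>] by (simp add: m_def emeasure_eq_measure)
  have g_int: "integrable M g" and g_eq: "(\<integral>x. g x \<partial>M) = m"
    unfolding g_def m_def by (auto simp: sets_M emeasure_eq_measure less_top[symmetric])
  have g_sq: "(g x)\<^sup>2 = g x" for x by (simp add: g_def indicator_def)
  \<comment> \<open>With 1/8 above and 1/5 here, the two estimates below give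
    \<open>m < 1/4 * ip p p + 2/5 * m\<close> and \<open>ip p p \<le> 12/5 * m\<close>, hence
    \<open>m < m\<close>.\<close>
  obtain p where p: "(\<integral>x. (g x - poly p x)\<^sup>2 \<partial>M) < m / 5"
    using approx[OF \<delta>, of "m / 5"] m unfolding g_def by auto
  have int_gp: "integrable M (\<lambda>x. g x * (poly p x)\<^sup>2)"
    using integrable_real_mult_indicator[OF _ poly_square_integrable[of p], of "{0<..<\<delta>}"]
    by (simp add: sets_M mult.commute g_def)
  have int_g1: "integrable M (\<lambda>x. g x * poly p x)"
    using integrable_real_mult_indicator[OF _ integrable_poly[of p], of "{0<..<\<delta>}"]
    by (simp add: sets_M mult.commute g_def)
  have int_d: "integrable M (\<lambda>x. (g x - poly p x)\<^sup>2)"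
    using g_int int_g1 poly_square_integrable[of p] by (simp add: power2_diff g_sq mult.assoc)
  have "m \<le> (\<integral>x. 2 * (g x * (poly p x)\<^sup>2) + 2 * (g x - poly p x)\<^sup>2 \<partial>M)"
    unfolding g_eq[symmetric]
  proof (rule integral_mono)
    fix x
    have "1 \<le> 2 * y\<^sup>2 + 2 * (1 - y)\<^sup>2" for y :: real
      using zero_le_power2[of "2 * y - 1"] by (simp add: power2_eq_square algebra_simps)
    then show "g x \<le> 2 * (g x * (poly p x)\<^sup>2) + 2 * (g x - poly p x)\<^sup>2"
      by (simp add: g_def indicator_def)
  qed (use g_int int_gp int_d in auto)
  also have "\<dots> = 2 * (\<integral>x. g x * (poly p x)\<^sup>2 \<partial>M) + 2 * (\<integral>x. (g x - poly p x)\<^sup>2 \<partial>M)"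
    using int_gp int_d by simp
  also have "\<dots> < 2 * (1/8 * ip p p) + 2 * (m / 5)"
    using small[of p] p unfolding g_def by linarith
  finally have 1: "m < 1/4 * ip p p + 2/5 * m" by simp
  have "ip p p \<le> (\<integral>x. 2 * g x + 2 * (g x - poly p x)\<^sup>2 \<partial>M)"
    unfolding ip_self
  proof (rule integral_mono)
    fix x
    have "(poly p x)\<^sup>2 \<le> 2 * (g x)\<^sup>2 + 2 * (g x - poly p x)\<^sup>2"
      using zero_le_power2[of "2 * g x - poly p x"] by (simp add: power2_eq_square algebra_simps)
    then show "(poly p x)\<^sup>2 \<le> 2 * g x + 2 * (g x - poly p x)\<^sup>2" by (simp add: g_sq)
  qed (use g_int int_d poly_square_integrable in auto)
  also have "\<dots> = 2 * m + 2 * (\<integral>x. (g x - poly p x)\<^sup>2 \<partial>M)"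
    using g_int int_d by (simp add: g_eq)
  finally have "ip p p \<le> 2 * m + 2 * (m / 5)" using p by linarith
  with 1 m show False by linarith
qed

end

section \<open>Supports and complex square-integrable functions\<close>

text \<open>The complement of the support is the union of all null open sets; by Lindelof countably
  many of them cover it.\<close>

lemma AE_in_msupport:
  fixes M :: "'a::second_countable_topology measure"
  assumes "sets M = sets borel"
  shows "AE x in M. x \<in> msupport M"
proof -
  define F where "F = {U. open U \<and> emeasure M U = 0}"
  obtain G where G: "G \<subseteq> F" "countable G" "\<Union>G = \<Union>F"
    using Lindelof[of F] unfolding F_def by auto
  have "\<Union>G \<in> null_sets M"
  proof -
    have "(\<Union>U\<in>G. U) \<in> null_sets M"
      using G assms by (intro null_sets_UN') (auto simp: F_def null_sets_def)
    then show ?thesis by simp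
  qed
  moreover have "{x \<in> space M. x \<notin> msupport M} \<subseteq> \<Union>F"
    by (auto simp: F_def msupport_def not_gr_zero)
  ultimately show ?thesis using G by (intro AE_I'[of "\<Union>G"]) auto
qed

lemma Re_poly_of_real: "Re (poly p (complex_of_real x)) = poly (map_poly Re p) x"
  by (induction p) (auto simp: map_poly_pCons)

lemma poly_fun_of_real: "poly_fun (map_poly complex_of_real p) x = complex_of_real (poly p x)"
  unfolding poly_fun_def by (induction p) (auto simp: map_poly_pCons)

lemma L2_norm_power2: "(L2_norm M f)\<^sup>2 = (\<integral>x. (norm (f x))\<^sup>2 \<partial>M)"
  by (simp add: L2_norm_def)

lemma L2_norm_less_iff: "0 < \<epsilon> \<Longrightarrow> L2_norm M f < \<epsilon> \<longleftrightarrow> (\<integral>x. (norm (f x))\<^sup>2 \<partial>M) < \<epsilon>\<^sup>2"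
  unfolding L2_norm_def using real_sqrt_less_iff[of _ "\<epsilon>\<^sup>2"] by simp

text \<open>This weak triangle inequality suffices: two errors with squared norms below a quarter of
  \<open>\<epsilon>\<^sup>2\<close> add up to one with squared norm below
  \<open>\<epsilon>\<^sup>2\<close>.\<close>

lemma
  assumes f: "f \<in> L2_space M" and g: "g \<in> L2_space M"
  shows L2_space_add: "(\<lambda>x. f x + g x) \<in> L2_space M"
    and L2_norm_add_le: "(L2_norm M (\<lambda>x. f x + g x))\<^sup>2 \<le> 2 * (L2_norm M f)\<^sup>2 + 2 * (L2_norm M g)\<^sup>2"
proof -
  have [measurable]: "f \<in> borel_measurable M" "g \<in> borel_measurable M"
    using f g by (auto simp: L2_space_def)
  have int: "integrable M (\<lambda>x. (norm (f x))\<^sup>2)" "integrable M (\<lambda>x. (norm (g x))\<^sup>2)"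
    using f g by (auto simp: L2_space_def)
  have le: "(norm (f x + g x))\<^sup>2 \<le> 2 * (norm (f x))\<^sup>2 + 2 * (norm (g x))\<^sup>2" for x
  proof -
    have "(norm (f x + g x))\<^sup>2 \<le> (norm (f x) + norm (g x))\<^sup>2"
      by (intro power_mono norm_triangle_ineq) auto
    also have "\<dots> \<le> 2 * (norm (f x))\<^sup>2 + 2 * (norm (g x))\<^sup>2"
      using sum_squares_bound[of "norm (f x)" "norm (g x)"] by (simp add: power2_sum)
    finally show ?thesis .
  qed
  have int': "integrable M (\<lambda>x. (norm (f x + g x))\<^sup>2)"
    by (rule Bochner_Integration.integrable_bound[of _ "\<lambda>x. 2 * (norm (f x))\<^sup>2 + 2 * (norm (g x))\<^sup>2"])
      (use int le in auto)
  then show "(\<lambda>x. f x + g x) \<in> L2_space M" by (simp add: L2_space_def)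
  have "(\<integral>x. (norm (f x + g x))\<^sup>2 \<partial>M) \<le> (\<integral>x. 2 * (norm (f x))\<^sup>2 + 2 * (norm (g x))\<^sup>2 \<partial>M)"
    using int int' le by (intro integral_mono) auto
  then show "(L2_norm M (\<lambda>x. f x + g x))\<^sup>2 \<le> 2 * (L2_norm M f)\<^sup>2 + 2 * (L2_norm M g)\<^sup>2"
    using int by (simp add: L2_norm_power2)
qed

section \<open>Weighted measures and induction on the power of x\<close>

text \<open>The norm of \<open>p\<close> for the weighted measure is that of
  \<open>monom 1 k * p\<close> for \<open>M\<close>, and the weight is positive on
  \<open>{0<..<\<delta>}\<close>, so no mass near 0 is lost.\<close>

lemma positive_moments_density:
  assumes M: "positive_moments M"
  shows "positive_moments (density M (\<lambda>x. ennreal (x ^ (2 * k))))"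
proof -
  interpret positive_moments M by (rule M)
  have nonneg: "0 \<le> x ^ (2 * k)" for x :: real by (simp add: zero_le_even_power)
  show ?thesis
  proof
    show "sets (density M (\<lambda>x. ennreal (x ^ (2 * k)))) = sets borel" by (simp add: sets_M)
    show "AE x in density M (\<lambda>x. ennreal (x ^ (2 * k))). 0 < x"
      using AE_pos by (subst AE_density) auto
    show "integrable (density M (\<lambda>x. ennreal (x ^ (2 * k)))) (\<lambda>x. (poly p x)\<^sup>2)" for p
      using poly_square_integrable[of "monom 1 k * p"] nonneg
      by (subst integrable_density)
        (auto simp: poly_monom power_mult_distrib mult.commute simp flip: power_mult)
    fix \<delta> :: real
    assume "0 < \<delta>"
    show "0 < emeasure (density M (\<lambda>x. ennreal (x ^ (2 * k)))) {0<..<\<delta>}"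
    proof (rule ccontr)
      assume "\<not> ?thesis"
      then have "{0<..<\<delta>} \<in> null_sets (density M (\<lambda>x. ennreal (x ^ (2 * k))))"
        by (intro null_setsI) (auto simp: sets_M)
      then have "AE x in M. x \<in> {0<..<\<delta>} \<longrightarrow> ennreal (x ^ (2 * k)) = 0"
        by (subst (asm) null_sets_density_iff) auto
      then have "AE x in M. x \<notin> {0<..<\<delta>}"
      proof eventually_elim
        case (elim x)
        show ?case
        proof
          assume "x \<in> {0<..<\<delta>}"
          with elim have "x ^ (2 * k) \<le> 0" "0 < x" by (auto simp: ennreal_eq_0_iff)
          then show False using zero_less_power[of x "2 * k"] by linarith
        qed
      qed
      then have "emeasure M {0<..<\<delta>} = 0"
        by (subst (asm) AE_iff_measurable[of "{0<..<\<delta>}"])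
          (auto simp: sets_M sets_eq_imp_space_eq[OF sets_M])
      with near_zero[OF \<open>0 < \<delta>\<close>] show False by simp
    qed
  qed
qed

text \<open>To gain a factor x, \<open>p\<close> is replaced by \<open>p - smult c R\<close> with
  \<open>c = poly p 0\<close> and \<open>R\<close> equal to 1 at 0; the difference is divisible by
  x, at the cost of the norm of \<open>c\<close> times \<open>R\<close> in the weighted space.
  Arbitrary \<open>f\<close> in the induction lets its hypothesis also supply the approximations
  from which \<open>R\<close> is obtained.\<close>

lemma power_times_poly_approx:
  fixes \<mu> :: "real measure"
  assumes pm: "positive_moments \<mu>"
    and polys: "range poly_fun \<subseteq> L2_space \<mu>"
    and dense: "L2_dense \<mu> (range poly_fun)"
  shows "f \<in> L2_space \<mu> \<Longrightarrow> 0 < \<epsilon> \<Longrightarrow>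
    \<exists>p. L2_norm \<mu> (\<lambda>x. f x - poly_fun (monom 1 k * p) x) < \<epsilon>"
proof (induction k arbitrary: f \<epsilon>)
  case 0
  then show ?case using dense unfolding L2_dense_def by auto
next
  case (Suc k)
  interpret positive_moments \<mu> by (rule pm)
  define \<nu> where "\<nu> = density \<mu> (\<lambda>x. ennreal (x ^ (2 * k)))"
  interpret \<nu>: positive_moments \<nu> unfolding \<nu>_def by (rule positive_moments_density[OF pm])
  have \<nu>_integral: "(\<integral>x. (g x)\<^sup>2 \<partial>\<nu>) = (\<integral>x. (x ^ k * g x)\<^sup>2 \<partial>\<mu>)"
    if [measurable]: "g \<in> borel_measurable \<mu>" for g :: "real \<Rightarrow> real"
    unfolding \<nu>_def
    by (subst integral_density)
      (auto simp: power_mult_distrib zero_le_even_power mult.commute simp flip: power_mult)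
  have diff: "(\<lambda>x. f x - poly_fun p x) \<in> L2_space \<mu>" if "f \<in> L2_space \<mu>" for f p
    using L2_space_add[OF that, of "poly_fun (- p)"] polys by (auto simp: poly_fun_def)
  have normalized: "\<exists>r. poly r 0 = 1 \<and> (\<integral>x. (poly r x)\<^sup>2 \<partial>\<nu>) < \<eta>" if "0 < \<eta>" for \<eta>
  proof (rule \<nu>.small_poly_normalized_at_zero[OF _ that])
    fix \<delta> \<xi> :: real
    assume "0 < \<delta>" "0 < \<xi>"
    \<comment> \<open>Approximating the indicator by \<open>p\<close> in the space of \<nu> amounts
      to approximating \<open>h\<close> by \<open>monom 1 k * p\<close> in that of \<mu>, where the
      induction hypothesis applies.\<close>
    define h where "h x = x ^ k * indicator {0<..<\<delta>} x" for x :: real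
    have [measurable]: "h \<in> borel_measurable \<mu>" unfolding h_def by measurable
    have "h x \<le> \<delta> ^ k" "0 \<le> h x" for x
      using \<open>0 < \<delta>\<close> by (auto simp: h_def indicator_def power_mono)
    then have "norm ((h x)\<^sup>2) \<le> (\<delta> ^ k)\<^sup>2" for x by (simp add: power_mono)
    then have "integrable \<mu> (\<lambda>x. (h x)\<^sup>2)"
      by (intro integrable_const_bound[where B = "(\<delta> ^ k)\<^sup>2"]) auto
    then have h: "(\<lambda>x. complex_of_real (h x)) \<in> L2_space \<mu>"
      by (simp add: L2_space_def)
    then obtain p where
      p: "L2_norm \<mu> (\<lambda>x. complex_of_real (h x) - poly_fun (monom 1 k * p) x) < sqrt \<xi>"
      using Suc.IH[of _ "sqrt \<xi>"] \<open>0 < \<xi>\<close> by auto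
    have "(\<integral>x. (indicator {0<..<\<delta>} x - poly (map_poly Re p) x)\<^sup>2 \<partial>\<nu>)
        = (\<integral>x. (x ^ k * (indicator {0<..<\<delta>} x - poly (map_poly Re p) x))\<^sup>2 \<partial>\<mu>)"
      by (rule \<nu>_integral) measurable
    \<comment> \<open>Since \<open>h\<close> is real, discarding the imaginary parts of the
      coefficients can only reduce the distance.\<close>
    also have "\<dots> \<le> (\<integral>x. (norm (complex_of_real (h x) - poly_fun (monom 1 k * p) x))\<^sup>2 \<partial>\<mu>)"
    proof (rule integral_mono_AE')
      show "integrable \<mu> (\<lambda>x. (norm (complex_of_real (h x) - poly_fun (monom 1 k * p) x))\<^sup>2)"
        using diff[OF h] by (simp add: L2_space_def)
      show "AE x in \<mu>. (x ^ k * (indicator {0<..<\<delta>} x - poly (map_poly Re p) x))\<^sup>2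
          \<le> (norm (complex_of_real (h x) - poly_fun (monom 1 k * p) x))\<^sup>2"
      proof (rule AE_I2)
        fix x
        have "x ^ k * (indicator {0<..<\<delta>} x - poly (map_poly Re p) x)
            = Re (complex_of_real (h x) - poly_fun (monom 1 k * p) x)"
          by (simp add: h_def poly_fun_def poly_monom Re_poly_of_real algebra_simps
              flip: of_real_power)
        then show "(x ^ k * (indicator {0<..<\<delta>} x - poly (map_poly Re p) x))\<^sup>2
          \<le> (norm (complex_of_real (h x) - poly_fun (monom 1 k * p) x))\<^sup>2"
          by (simp only: cmod_power2 le_add_same_cancel1 zero_le_power2)
      qed
    qed auto
    also have "\<dots> < \<xi>" using p \<open>0 < \<xi>\<close> by (simp add: L2_norm_less_iff)
    finally show "\<exists>p. (\<integral>x. (indicator {0<..<\<delta>} x - poly p x)\<^sup>2 \<partial>\<nu>) < \<xi>" by blast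
  qed
  obtain p where p: "L2_norm \<mu> (\<lambda>x. f x - poly_fun (monom 1 k * p) x) < \<epsilon> / 2"
    using Suc.IH[OF Suc.prems(1), of "\<epsilon> / 2"] Suc.prems(2) by auto
  define c where "c = poly p 0"
  \<comment> \<open>The tolerance depends on \<open>c\<close>, so \<open>p\<close> is fixed first.
    Adding 1 in the denominator covers \<open>c = 0\<close>.\<close>
  obtain r where r0: "poly r 0 = 1" and r: "(\<integral>x. (poly r x)\<^sup>2 \<partial>\<nu>) < \<epsilon>\<^sup>2 / 4 / ((norm c)\<^sup>2 + 1)"
    using normalized[of "\<epsilon>\<^sup>2 / 4 / ((norm c)\<^sup>2 + 1)"] Suc.prems(2)
    by (auto simp: add_nonneg_pos)
  define R where "R = map_poly complex_of_real r"
  have R0: "poly R 0 = 1" using poly_fun_of_real[of r 0] r0 by (simp add: R_def poly_fun_def)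
  define q where "q = synthetic_div (p - smult c R) 0"
  have q: "p - smult c R = [:0, 1:] * q"
    using poly_eq_synthetic_div[of "p - smult c R" 0] R0 by (simp add: c_def q_def)
  have split: "f x - poly_fun (monom 1 (Suc k) * q) x
      = (f x - poly_fun (monom 1 k * p) x) + poly_fun (monom 1 k * smult c R) x" for x
  proof -
    have "monom 1 (Suc k) * q = monom 1 k * (p - smult c R)"
      unfolding q by (simp add: monom_Suc)
    then have "poly_fun (monom 1 (Suc k) * q) x
        = poly_fun (monom 1 k * p) x - poly_fun (monom 1 k * smult c R) x"
      by (simp only: poly_fun_def right_diff_distrib poly_diff)
    then show ?thesis by simp
  qed
  have "(L2_norm \<mu> (poly_fun (monom 1 k * smult c R)))\<^sup>2 = (norm c)\<^sup>2 * (\<integral>x. (poly r x)\<^sup>2 \<partial>\<nu>)"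
  proof -
    have "(norm (poly_fun (monom 1 k * smult c R) x))\<^sup>2 = (norm c)\<^sup>2 * (x ^ k * poly r x)\<^sup>2" for x
    proof -
      have "poly_fun (monom 1 k * smult c R) x = c * complex_of_real (x ^ k * poly r x)"
        using poly_fun_of_real[of r x] by (simp add: R_def poly_fun_def poly_monom)
      then show ?thesis by (simp only: norm_mult norm_of_real power_mult_distrib power2_abs abs_mult)
    qed
    then show ?thesis by (simp add: L2_norm_power2 \<nu>_integral)
  qed
  also have "\<dots> \<le> ((norm c)\<^sup>2 + 1) * (\<integral>x. (poly r x)\<^sup>2 \<partial>\<nu>)"
    by (intro mult_right_mono) auto
  also have "\<dots> < \<epsilon>\<^sup>2 / 4"
    using r by (subst (asm) pos_less_divide_eq) (auto simp: add_nonneg_pos mult.commute)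
  finally have "(L2_norm \<mu> (poly_fun (monom 1 k * smult c R)))\<^sup>2 < \<epsilon>\<^sup>2 / 4" .
  moreover have "(L2_norm \<mu> (\<lambda>x. f x - poly_fun (monom 1 k * p) x))\<^sup>2 < \<epsilon>\<^sup>2 / 4"
    using p Suc.prems(2) L2_norm_less_iff[of "\<epsilon> / 2" \<mu>]
    by (simp add: L2_norm_power2 power_divide)
  moreover have "(L2_norm \<mu> (\<lambda>x. f x - poly_fun (monom 1 (Suc k) * q) x))\<^sup>2
      \<le> 2 * (L2_norm \<mu> (\<lambda>x. f x - poly_fun (monom 1 k * p) x))\<^sup>2
        + 2 * (L2_norm \<mu> (poly_fun (monom 1 k * smult c R)))\<^sup>2"
    unfolding split by (rule L2_norm_add_le[OF diff[OF Suc.prems(1)]]) (use polys in blast)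
  ultimately have "(L2_norm \<mu> (\<lambda>x. f x - poly_fun (monom 1 (Suc k) * q) x))\<^sup>2 < \<epsilon>\<^sup>2"
    by linarith
  then have "L2_norm \<mu> (\<lambda>x. f x - poly_fun (monom 1 (Suc k) * q) x) < \<epsilon>"
    using Suc.prems(2) by (simp add: power_less_imp_less_base)
  then show ?case by blast
qed

section \<open>Spans of monomials and the density theorem\<close>

lemma fin_lin_combs_powers:
  "fin_lin_combs (\<lambda>j x. complex_of_real x ^ j) {m..} = range (\<lambda>p. poly_fun (monom 1 m * p))"
proof (intro equalityI subsetI)
  fix g
  assume "g \<in> fin_lin_combs (\<lambda>j x. complex_of_real x ^ j) {m..}"
  then obtain J c where g: "g = (\<lambda>x. \<Sum>j\<in>J. c j * complex_of_real x ^ j)" and "J \<subseteq> {m..}"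
    by (auto simp: fin_lin_combs_def)
  \<comment> \<open>The truncated difference \<open>j - m\<close> is exact because \<open>J\<close>
    lies in \<open>{m..}\<close>.\<close>
  then have "g = poly_fun (monom 1 m * (\<Sum>j\<in>J. monom (c j) (j - m)))"
    by (auto simp: fun_eq_iff poly_fun_def poly_sum poly_monom sum_distrib_left
        mult.left_commute simp flip: power_add intro!: sum.cong)
  then show "g \<in> range (\<lambda>p. poly_fun (monom 1 m * p))" by blast
next
  fix g
  assume "g \<in> range (\<lambda>p. poly_fun (monom 1 m * p))"
  then obtain p where g: "g = poly_fun (monom 1 m * p)" by blast
  have "g = (\<lambda>x. \<Sum>j\<in>(+) m ` {..degree p}. coeff p (j - m) * complex_of_real x ^ j)"
    unfolding g
    by (auto simp: fun_eq_iff poly_fun_def poly_monom poly_altdef[of p] sum_distrib_left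
        sum.reindex power_add mult.left_commute)
  then show "g \<in> fin_lin_combs (\<lambda>j x. complex_of_real x ^ j) {m..}"
    unfolding fin_lin_combs_def
    by (intro CollectI exI[of _ "(+) m ` {..degree p}"] exI[of _ "\<lambda>j. coeff p (j - m)"]) auto
qed

theorem theorem3p1:
  fixes \<mu> :: "real measure" and n :: nat
  assumes "prob_space \<mu>" and "sets \<mu> = sets borel"
    and "range poly_fun \<subseteq> L2_space \<mu>"
    and "L2_dense \<mu> (range poly_fun)"
    and "msupport \<mu> \<subseteq> {0..}"
    and "0 \<in> msupport \<mu>"
    and "\<not> (0 isolated_in msupport \<mu>)"
    and "measure \<mu> {0} = 0"
  shows "L2_dense \<mu> (fin_lin_combs (\<lambda>j x. complex_of_real x ^ j) {n+1..})"
proof -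
  interpret prob_space \<mu> by fact
  have "{0} \<in> null_sets \<mu>"
    using assms(2,8) by (intro null_setsI) (auto simp: emeasure_eq_measure)
  then have AE_ne: "AE x in \<mu>. x \<noteq> 0"
    by (auto dest: AE_not_in)
  have AE_pos: "AE x in \<mu>. 0 < x"
    using AE_in_msupport[OF assms(2)] AE_ne
    by eventually_elim (use assms(5) in force)
  have "positive_moments \<mu>"
  proof
    show "integrable \<mu> (\<lambda>x. (poly p x)\<^sup>2)" for p :: "real poly"
    proof -
      have "poly_fun (map_poly complex_of_real p) \<in> L2_space \<mu>" using assms(3) by blast
      then show ?thesis by (simp add: L2_space_def poly_fun_of_real)
    qed
    fix \<delta> :: real
    assume "0 < \<delta>"
    then have "0 < emeasure \<mu> {-\<delta><..<\<delta>}"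
      using assms(6) unfolding msupport_def by auto
    \<comment> \<open>The two intervals differ only in nonpositive points, which form a null
      set.\<close>
    also have "emeasure \<mu> {-\<delta><..<\<delta>} = emeasure \<mu> {0<..<\<delta>}"
      by (rule emeasure_eq_AE) (use AE_pos \<open>0 < \<delta>\<close> assms(2) in \<open>auto elim: eventually_mono\<close>)
    finally show "0 < emeasure \<mu> {0<..<\<delta>}" .
  qed (fact assms(2) AE_pos)+
  then show ?thesis
    unfolding L2_dense_def fin_lin_combs_powers
    using power_times_poly_approx[OF _ assms(3,4), of _ _ "n + 1"] assms(3) by fastforce
qed

end
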